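(* Under homogeneous Dirichlet or periodic boundary conditions, and in the absence of external force ($\bm f=\bm 0$), both of the following time-discrete schemes (CN1 and CN2) preserve the discrete energy dissipation law $$\frac{E^{n+1}-E^n}{\tau}=-\nu\|\nabla\bm u^{n+\frac12}\|^2,\qquad E^n=\frac12\|\bm u^n\|^2,$$ at every step $n$ at which the scheme is applied, where $\bm u^{n+\frac12}=(\bm u^n+\bm u^{n+1})/2$. CN1: given $\bm u^0$, for $0\le n\le N_t-1$ the pair $(\bm u^{n+1},p^{n+\frac12})$ satisfies $$\frac{\bm u^{n+1}-\bm u^n}{\tau}-\nu\Delta\bm u^{n+\frac12}+\bm B(\bm u^n,\bm u^{n+\frac12})+\nabla p^{n+\frac12}=\bm f^{n+\frac12},\qquad \nabla\cdot\bm u^{n+\frac12}=0 .$$ CN2: given $\bm u^0$, and $\bm u^1$ obtained from the CN1 scheme, for $1\le n\le N_t-1$ the pair $(\bm u^{n+1},p^{n+\frac12})$ satisfies $$\frac{\bm u^{n+1}-\bm u^n}{\tau}-\nu\Delta\bm u^{n+\frac12}+\bm B(\overline{\bm u}^{n+\frac12},\bm u^{n+\frac12})+\nabla p^{n+\frac12}=\bm f^{n+\frac12},\qquad \nabla\cdot\bm u^{n+\frac12}=0,$$ with $\overline{\bm u}^{n+\frac12}=(3\bm u^n-\bm u^{n-1})/2$.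
   Context: $\Omega\subset\mathbb R^d$ ($d=2,3$) is a rectangular domain, $\nu>0$, $T>0$, $N_t$ is a positive integer, $\tau=T/N_t$, $t_n=n\tau$; $\bm f^{n+\frac12}$ is the external force at time $t_n+\tau/2$. $(\cdot,\cdot)$ and $\|\cdot\|$ denote the $L^2(\Omega)$ inner product and norm (for vector and matrix fields, summed over components). The $\bm u^n$ are $\mathbb R^d$-valued velocity fields on $\Omega$ and $p^{n+\frac12}$ are scalar pressures. All $\bm u^n$ (including the initial datum $\bm u^0$) satisfy the same boundary condition: either $\bm u^n=\bm 0$ on $\partial\Omega$ (homogeneous Dirichlet), or periodicity (then pressures are periodic too). All fields are smooth enough for the expressions to make sense. $(\bm u\cdot\nabla\bm u)_i=\sum_j u_j\partial_j u_i$. $\bm F$ is a user-specified map taking a vector field $\bm u$ on $\Omega$ to a vector field $\bm F(\bm u)$ on $\Omega$ and satisfying the non-degeneracy condition $(\bm F(\bm u),\bm u)\neq 0$ whenever $\|\bm u\|\neq 0$. Define $$\bm G(\bm u)=\frac{\bm u\cdot\nabla\bm u}{(\bm F(\bm u),\bm u)}\ \text{ if }\|\bm u\|\ne0,\qquad \bm G(\bm u)=\bm 0\ \text{ otherwise},$$ $$\bm B(\bm u,\bm v)=\big(\bm F(\bm u),\bm v\big)\bm G(\bm u)-\big(\bm G(\bm u),\bm v\big)\bm F(\bm u).$$ *)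

theory Defs
  imports "HOL-Analysis.Analysis"
begin

text \<open>
  Fields on a domain \<open>\<Omega> \<subseteq> \<real>\<^sup>d\<close> are total functions on \<open>real ^ 'd\<close>. All differential operators are
  evaluated at points of the open set \<open>\<Omega>\<close> only, where they do not depend on values outside \<open>\<Omega>\<close>.
\<close>

definition pd :: "'d::finite \<Rightarrow> (real ^ 'd \<Rightarrow> 'b::real_normed_vector) \<Rightarrow> real ^ 'd \<Rightarrow> 'b" where
  "pd j f x = frechet_derivative f (at x) (axis j 1)"

definition grad :: "(real ^ 'd::finite \<Rightarrow> real) \<Rightarrow> real ^ 'd \<Rightarrow> real ^ 'd" where
  "grad q x = (\<chi> i. pd i q x)"

definition Grad :: "(real ^ 'd::finite \<Rightarrow> real ^ 'd) \<Rightarrow> real ^ 'd \<Rightarrow> real ^ 'd ^ 'd" where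
  "Grad u x = (\<chi> i j. pd j (\<lambda>y. u y $ i) x)"

definition divergence :: "(real ^ 'd::finite \<Rightarrow> real ^ 'd) \<Rightarrow> real ^ 'd \<Rightarrow> real" where
  "divergence u x = (\<Sum>j\<in>UNIV. pd j (\<lambda>y. u y $ j) x)"

definition laplacian :: "(real ^ 'd::finite \<Rightarrow> real ^ 'd) \<Rightarrow> real ^ 'd \<Rightarrow> real ^ 'd" where
  "laplacian u x = (\<chi> i. \<Sum>j\<in>UNIV. pd j (pd j (\<lambda>y. u y $ i)) x)"

definition convection :: "(real ^ 'd::finite \<Rightarrow> real ^ 'd) \<Rightarrow> real ^ 'd \<Rightarrow> real ^ 'd" where
  "convection u x = (\<chi> i. \<Sum>j\<in>UNIV. u x $ j * pd j (\<lambda>y. u y $ i) x)"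

text \<open>
  On \<open>real ^ 'd\<close> and \<open>real ^ 'd ^ 'd\<close> the library inner product is the sum over all components
  (for matrices, the Frobenius product).
\<close>

definition in_L2 :: "(real ^ 'd::finite) set \<Rightarrow> (real ^ 'd \<Rightarrow> 'b::euclidean_space) \<Rightarrow> bool" where
  "in_L2 \<Omega> f \<longleftrightarrow> f \<in> borel_measurable (lebesgue_on \<Omega>) \<and>
     integrable (lebesgue_on \<Omega>) (\<lambda>x. (norm (f x))\<^sup>2)"

definition L2_inner :: "(real ^ 'd::finite) set \<Rightarrow> (real ^ 'd \<Rightarrow> 'b::euclidean_space) \<Rightarrow>
    (real ^ 'd \<Rightarrow> 'b) \<Rightarrow> real" where
  "L2_inner \<Omega> f g = integral\<^sup>L (lebesgue_on \<Omega>) (\<lambda>x. f x \<bullet> g x)"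

definition L2_norm :: "(real ^ 'd::finite) set \<Rightarrow> (real ^ 'd \<Rightarrow> 'b::euclidean_space) \<Rightarrow> real" where
  "L2_norm \<Omega> f = sqrt (L2_inner \<Omega> f f)"

text \<open>
  \<open>Ck_closure k \<Omega> f\<close> says that \<open>f\<close> is of class \<open>C\<^sup>k\<close> up to the boundary of the open set \<open>\<Omega>\<close>: the
  partial derivatives of order at most \<open>k\<close> exist in \<open>\<Omega>\<close> and extend continuously to its closure.
  The extension \<open>g\<close> is needed because on the boundary the term \<open>pd j f\<close> would depend on the
  (irrelevant) values of \<open>f\<close> outside the closure. For \<open>\<Omega> = UNIV\<close> this is the usual \<open>C\<^sup>k\<close>.
\<close>

primrec Ck_closure :: "nat \<Rightarrow> (real ^ 'd::finite) set \<Rightarrow>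
    (real ^ 'd \<Rightarrow> 'b::real_normed_vector) \<Rightarrow> bool" where
  "Ck_closure 0 \<Omega> f \<longleftrightarrow> continuous_on (closure \<Omega>) f"
| "Ck_closure (Suc k) \<Omega> f \<longleftrightarrow> continuous_on (closure \<Omega>) f \<and> (\<forall>x\<in>\<Omega>. f differentiable (at x)) \<and>
     (\<forall>j. \<exists>g. Ck_closure k \<Omega> g \<and> (\<forall>x\<in>\<Omega>. g x = pd j f x))"

definition box_periodic :: "real ^ 'd::finite \<Rightarrow> real ^ 'd \<Rightarrow> (real ^ 'd \<Rightarrow> 'b) \<Rightarrow> bool" where
  "box_periodic a b f \<longleftrightarrow> (\<forall>j x. f (x + axis j (b $ j - a $ j)) = f x)"

datatype boundary_condition = Dirichlet | Periodic

text \<open>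
  Periodic fields on the rectangle \<open>box a b\<close> are represented by their periodic extension to the
  whole space, which carries the regularity.
\<close>

fun velocity_field :: "nat \<Rightarrow> boundary_condition \<Rightarrow> real ^ 'd::finite \<Rightarrow> real ^ 'd \<Rightarrow>
    (real ^ 'd \<Rightarrow> real ^ 'd) \<Rightarrow> bool" where
  "velocity_field k Dirichlet a b u \<longleftrightarrow>
     Ck_closure k (box a b) u \<and> (\<forall>x\<in>frontier (box a b). u x = 0)"
| "velocity_field k Periodic a b u \<longleftrightarrow> Ck_closure k UNIV u \<and> box_periodic a b u"

fun pressure_field :: "boundary_condition \<Rightarrow> real ^ 'd::finite \<Rightarrow> real ^ 'd \<Rightarrow>
    (real ^ 'd \<Rightarrow> real) \<Rightarrow> bool" where
  "pressure_field Dirichlet a b q \<longleftrightarrow> Ck_closure 1 (box a b) q"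
| "pressure_field Periodic a b q \<longleftrightarrow> Ck_closure 1 UNIV q \<and> box_periodic a b q"

definition G_map :: "(real ^ 'd::finite) set \<Rightarrow> ((real ^ 'd \<Rightarrow> real ^ 'd) \<Rightarrow> real ^ 'd \<Rightarrow> real ^ 'd) \<Rightarrow>
    (real ^ 'd \<Rightarrow> real ^ 'd) \<Rightarrow> real ^ 'd \<Rightarrow> real ^ 'd" where
  "G_map \<Omega> F u x =
     (if L2_norm \<Omega> u \<noteq> 0 then convection u x /\<^sub>R L2_inner \<Omega> (F u) u else 0)"

definition B_map :: "(real ^ 'd::finite) set \<Rightarrow> ((real ^ 'd \<Rightarrow> real ^ 'd) \<Rightarrow> real ^ 'd \<Rightarrow> real ^ 'd) \<Rightarrow>
    (real ^ 'd \<Rightarrow> real ^ 'd) \<Rightarrow> (real ^ 'd \<Rightarrow> real ^ 'd) \<Rightarrow> real ^ 'd \<Rightarrow> real ^ 'd" where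
  "B_map \<Omega> F u v x =
     L2_inner \<Omega> (F u) v *\<^sub>R G_map \<Omega> F u x - L2_inner \<Omega> (G_map \<Omega> F u) v *\<^sub>R F u x"

definition midpoint_field :: "(nat \<Rightarrow> real ^ 'd::finite \<Rightarrow> real ^ 'd) \<Rightarrow> nat \<Rightarrow> real ^ 'd \<Rightarrow> real ^ 'd" where
  "midpoint_field u n x = (u n x + u (Suc n) x) /\<^sub>R 2"

definition extrapolated_field :: "(nat \<Rightarrow> real ^ 'd::finite \<Rightarrow> real ^ 'd) \<Rightarrow> nat \<Rightarrow> real ^ 'd \<Rightarrow> real ^ 'd" where
  "extrapolated_field u n x = (3 *\<^sub>R u n x - u (n - 1) x) /\<^sub>R 2"

text \<open>
  One Crank--Nicolson step from \<open>u n\<close> to \<open>u (Suc n)\<close> in which the first argument of \<open>B\<close> is \<open>w\<close>.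
  The value \<open>p n\<close> is the pressure at time \<open>n \<tau> + \<tau>/2\<close>, and \<open>f t\<close> is the external force at time \<open>t\<close>.
\<close>

definition CN_step :: "(real ^ 'd::finite) set \<Rightarrow> real \<Rightarrow> real \<Rightarrow>
    ((real ^ 'd \<Rightarrow> real ^ 'd) \<Rightarrow> real ^ 'd \<Rightarrow> real ^ 'd) \<Rightarrow> (real \<Rightarrow> real ^ 'd \<Rightarrow> real ^ 'd) \<Rightarrow>
    (real ^ 'd \<Rightarrow> real ^ 'd) \<Rightarrow> (nat \<Rightarrow> real ^ 'd \<Rightarrow> real ^ 'd) \<Rightarrow> (nat \<Rightarrow> real ^ 'd \<Rightarrow> real) \<Rightarrow>
    nat \<Rightarrow> bool" where
  "CN_step \<Omega> \<nu> \<tau> F f w u p n \<longleftrightarrow>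
     (\<forall>x\<in>\<Omega>. (u (Suc n) x - u n x) /\<^sub>R \<tau> - \<nu> *\<^sub>R laplacian (midpoint_field u n) x
              + B_map \<Omega> F w (midpoint_field u n) x + grad (p n) x = f (real n * \<tau> + \<tau> / 2) x) \<and>
     (\<forall>x\<in>\<Omega>. divergence (midpoint_field u n) x = 0)"

definition CN1_step where
  "CN1_step \<Omega> \<nu> \<tau> F f u p n \<longleftrightarrow> CN_step \<Omega> \<nu> \<tau> F f (u n) u p n"

definition CN2_step where
  "CN2_step \<Omega> \<nu> \<tau> F f u p n \<longleftrightarrow> CN_step \<Omega> \<nu> \<tau> F f (extrapolated_field u n) u p n"

definition CN1_scheme where
  "CN1_scheme \<Omega> \<nu> \<tau> F f N u p \<longleftrightarrow> (\<forall>n<N. CN1_step \<Omega> \<nu> \<tau> F f u p n)"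

definition CN2_scheme where
  "CN2_scheme \<Omega> \<nu> \<tau> F f N u p \<longleftrightarrow>
     CN1_step \<Omega> \<nu> \<tau> F f u p 0 \<and> (\<forall>n. 1 \<le> n \<and> n < N \<longrightarrow> CN2_step \<Omega> \<nu> \<tau> F f u p n)"

definition energy :: "(real ^ 'd::finite) set \<Rightarrow> (real ^ 'd \<Rightarrow> real ^ 'd) \<Rightarrow> real" where
  "energy \<Omega> v = (L2_norm \<Omega> v)\<^sup>2 / 2"

definition energy_law :: "(real ^ 'd::finite) set \<Rightarrow> real \<Rightarrow> real \<Rightarrow>
    (nat \<Rightarrow> real ^ 'd \<Rightarrow> real ^ 'd) \<Rightarrow> nat \<Rightarrow> bool" where
  "energy_law \<Omega> \<nu> \<tau> u n \<longleftrightarrow>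
     (energy \<Omega> (u (Suc n)) - energy \<Omega> (u n)) / \<tau> = - \<nu> * (L2_norm \<Omega> (Grad (midpoint_field u n)))\<^sup>2"

end

theory Submission imports Defs begin

text \<open>
  Write \<open>v\<close> for the midpoint \<open>(u\<^sup>n + u\<^sup>n\<^sup>+\<^sup>1) / 2\<close> and take the \<open>L\<^sup>2\<close> inner product of the momentum equation
  with \<open>v\<close>. The difference quotient becomes \<open>(E\<^sup>n\<^sup>+\<^sup>1 - E\<^sup>n) / \<tau>\<close>, because
  \<open>(x - y) \<bullet> (x + y) = x \<bullet> x - y \<bullet> y\<close>. The nonlinear term vanishes whatever its first argument \<open>w\<close> is:
  \<open>(B(w,v), v) = (F(w),v) (G(w),v) - (G(w),v) (F(w),v) = 0\<close>. This is why one argument covers both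
  schemes, which differ only in \<open>w\<close>. Finally \<open>(\<nabla>p, v) = - (p, \<nabla>\<cdot>v) = 0\<close> and
  \<open>(\<Delta>v, v) = - \<parallel>\<nabla>v\<parallel>\<^sup>2\<close> by integration by parts without boundary terms, which leaves the energy law.
  The balance of one step is \<open>energy_law_if_CN_step\<close>.

  The analytic content is integration by parts on a rectangle. It reduces to the statement that a
  partial derivative \<open>\<partial>\<^sub>j h\<close> has integral zero over the rectangle if \<open>h\<close> takes equal values at
  opposite points of the two faces orthogonal to the \<open>j\<close>-th axis (\<open>integral_box_pd_eq_0\<close>): by Fubini
  it suffices to integrate along lines parallel to that axis, where the fundamental theorem of
  calculus applies. This condition on opposite faces treats the two boundary conditions at once.
  If one factor of a product vanishes on the boundary, so does the product; if both factors are
  periodic, the product is.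
\<close>

section \<open>Partial derivatives and regularity up to the boundary\<close>

lemma pd_eq_if_has_derivative:
  "(f has_derivative D) (at x) \<Longrightarrow> pd j f x = D (axis j 1)"
  unfolding pd_def by (simp add: frechet_derivative_at[symmetric])

lemma pd_bounded_linear:
  assumes "bounded_linear L" "f differentiable (at x)"
  shows "pd j (\<lambda>y. L (f y)) x = L (pd j f x)"
  using pd_eq_if_has_derivative[OF bounded_linear.has_derivative[OF assms(1)
      frechet_derivative_works[THEN iffD1, OF assms(2)]]]
  by (simp add: pd_def)

lemma pd_add:
  assumes "f differentiable (at x)" "g differentiable (at x)"
  shows "pd j (\<lambda>y. f y + g y) x = pd j f x + pd j g x"
  using pd_eq_if_has_derivative[OF has_derivative_add[OF
      frechet_derivative_works[THEN iffD1, OF assms(1)] frechet_derivative_works[THEN iffD1, OF assms(2)]]]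
  by (simp add: pd_def)

lemma pd_mult:
  fixes f g :: "real ^ 'd::finite \<Rightarrow> real"
  assumes "f differentiable (at x)" "g differentiable (at x)"
  shows "pd j (\<lambda>y. f y * g y) x = f x * pd j g x + pd j f x * g x"
  using pd_eq_if_has_derivative[OF has_derivative_mult[OF
      frechet_derivative_works[THEN iffD1, OF assms(1)] frechet_derivative_works[THEN iffD1, OF assms(2)]]]
  by (simp add: pd_def)

lemma pd_cong_open:
  assumes "open S" "x \<in> S" "\<And>y. y \<in> S \<Longrightarrow> f y = g y" "f differentiable (at x)"
  shows "pd j f x = pd j g x"
  unfolding pd_def using frechet_derivative_transform_within_open[OF assms(4,1,2)] assms(3) by simp

lemma pd_box_periodic:
  assumes "box_periodic a b f" "\<And>x. f differentiable (at x)"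
  shows "box_periodic a b (pd j f)"
  unfolding box_periodic_def
proof (intro allI)
  fix i x
  let ?c = "axis i (b $ i - a $ i)"
  have "((\<lambda>y. f (y + ?c)) has_derivative frechet_derivative f (at (x + ?c))) (at x)"
    by (rule has_derivative_compose[of "\<lambda>y. y + ?c" "\<lambda>h. h"])
      (auto intro!: derivative_eq_intros simp: frechet_derivative_works[symmetric] assms(2))
  moreover have "(\<lambda>y. f (y + ?c)) = f"
    using assms(1) by (auto simp: box_periodic_def)
  ultimately show "pd j f (x + ?c) = pd j f x"
    by (metis pd_def pd_eq_if_has_derivative)
qed

lemma Ck_closure_continuous: "Ck_closure k \<Omega> f \<Longrightarrow> continuous_on (closure \<Omega>) f"
  by (cases k) auto

lemma Ck_closure_Suc_imp: "Ck_closure (Suc k) \<Omega> f \<Longrightarrow> Ck_closure k \<Omega> f"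
proof (induction k arbitrary: f)
  case (Suc k)
  then show ?case
    unfolding Ck_closure.simps(2)[of "Suc k"] Ck_closure.simps(2)[of k] by blast
qed simp

lemma Ck_closure_antimono: "Ck_closure k \<Omega> f \<Longrightarrow> l \<le> k \<Longrightarrow> Ck_closure l \<Omega> f"
  by (induction k) (auto simp: le_Suc_eq dest: Ck_closure_Suc_imp simp del: Ck_closure.simps)

lemma Ck_closure_subset: "Ck_closure k \<Omega> f \<Longrightarrow> \<Omega>' \<subseteq> \<Omega> \<Longrightarrow> Ck_closure k \<Omega>' f"
proof (induction k arbitrary: f)
  case 0
  then show ?case by (auto intro: continuous_on_subset dest: closure_mono)
next
  case (Suc k)
  then show ?case
    by (auto intro: continuous_on_subset dest: closure_mono) (meson subsetD)
qed

lemma Ck_closure_bounded_linear: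
  assumes L: "bounded_linear L"
  shows "Ck_closure k \<Omega> f \<Longrightarrow> Ck_closure k \<Omega> (\<lambda>x. L (f x))"
proof (induction k arbitrary: f)
  case 0
  then show ?case by (simp add: bounded_linear.continuous_on[OF L])
next
  case (Suc k)
  have "\<exists>g. Ck_closure k \<Omega> g \<and> (\<forall>x\<in>\<Omega>. g x = pd j (\<lambda>x. L (f x)) x)" for j
  proof -
    obtain g where "Ck_closure k \<Omega> g" "\<forall>x\<in>\<Omega>. g x = pd j f x"
      using Suc.prems by (meson Ck_closure.simps(2))
    then show ?thesis
      using Suc.IH[of g] Suc.prems
      by (intro exI[of _ "\<lambda>x. L (g x)"]) (auto simp: pd_bounded_linear[OF L])
  qed
  moreover have "\<forall>x\<in>\<Omega>. (\<lambda>x. L (f x)) differentiable (at x)"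
    using Suc.prems bounded_linear.has_derivative[OF L]
    by (auto simp: differentiable_def) blast
  ultimately show ?case
    using Suc.prems by (auto simp: bounded_linear.continuous_on[OF L])
qed

lemma Ck_closure_add:
  "Ck_closure k \<Omega> f \<Longrightarrow> Ck_closure k \<Omega> g \<Longrightarrow> Ck_closure k \<Omega> (\<lambda>x. f x + g x)"
proof (induction k arbitrary: f g)
  case 0
  then show ?case by (auto intro: continuous_on_add)
next
  case (Suc k)
  have "\<exists>h. Ck_closure k \<Omega> h \<and> (\<forall>x\<in>\<Omega>. h x = pd j (\<lambda>x. f x + g x) x)" for j
  proof -
    obtain f' g' where "Ck_closure k \<Omega> f'" "\<forall>x\<in>\<Omega>. f' x = pd j f x"
        "Ck_closure k \<Omega> g'" "\<forall>x\<in>\<Omega>. g' x = pd j g x"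
      using Suc.prems by (meson Ck_closure.simps(2))
    then show ?thesis
      using Suc.IH[of f' g'] Suc.prems
      by (intro exI[of _ "\<lambda>x. f' x + g' x"]) (auto simp: pd_add)
  qed
  then show ?case using Suc.prems by (auto intro: continuous_on_add)
qed

lemma Ck_closure_component: "Ck_closure k \<Omega> v \<Longrightarrow> Ck_closure k \<Omega> (\<lambda>x. v x $ i)"
  by (rule Ck_closure_bounded_linear) (rule bounded_linear_vec_nth)

text \<open>
  The midpoint and the extrapolated field are linear combinations of iterates, so they inherit the
  regularity and the boundary condition.
\<close>

lemma velocity_field_lincomb:
  assumes "velocity_field k bc a b v" "velocity_field k bc a b w"
  shows "velocity_field k bc a b (\<lambda>x. s *\<^sub>R v x + t *\<^sub>R w x)"
  using assms
  by (cases bc)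
    (auto simp: box_periodic_def intro!: Ck_closure_add Ck_closure_bounded_linear[OF bounded_linear_scaleR_right])

lemma velocity_field_Ck_closure:
  "velocity_field k bc a b v \<Longrightarrow> Ck_closure k (box a b) v"
  by (cases bc) (auto intro: Ck_closure_subset)

lemma pressure_field_Ck_closure:
  "pressure_field bc a b q \<Longrightarrow> Ck_closure 1 (box a b) q"
  by (cases bc) (auto intro: Ck_closure_subset simp del: Ck_closure.simps One_nat_def)

section \<open>Integration by parts on a box\<close>

text \<open>
  This is Fubini's theorem with \<open>e\<close> as the inner direction. Lebesgue measure is the image of the product
  measure on coordinate functions; splitting off the coordinate \<open>e\<close> makes every inner integral an
  integral along a line of direction \<open>e\<close>.
\<close>

lemma integral_lborel_eq_0_if_lines:
  fixes f :: "'a::euclidean_space \<Rightarrow> real"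
  assumes e: "e \<in> Basis" and f: "integrable lborel f"
    and lines: "\<And>y. (LBINT t. f (y + t *\<^sub>R e)) = 0"
  shows "integral\<^sup>L lborel f = 0"
proof -
  define S :: "('a \<Rightarrow> real) \<Rightarrow> 'a" where "S y = (\<Sum>b\<in>Basis. y b *\<^sub>R b)" for y
  interpret product_sigma_finite "\<lambda>_::'a. lborel :: real measure" ..
  have S[measurable]: "S \<in> (\<Pi>\<^sub>M b\<in>Basis. lborel) \<rightarrow>\<^sub>M borel"
    unfolding S_def by measurable
  have lb: "lborel = distr (\<Pi>\<^sub>M b\<in>Basis. lborel) borel S"
    unfolding S_def[abs_def] by (rule lborel_eq)
  have [measurable]: "f \<in> borel_measurable borel" using f by simp
  have B: "Basis = insert e (Basis - {e})" using e by auto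
  have "integrable (\<Pi>\<^sub>M b\<in>Basis. lborel) (\<lambda>y. f (S y))"
    using f by (subst (asm) lb, subst (asm) integrable_distr_eq) auto
  then have int: "integrable (Pi\<^sub>M (insert e (Basis - {e})) (\<lambda>_. lborel)) (\<lambda>y. f (S y))"
    using B by simp
  have line: "S (y(e := t)) = S (y(e := 0)) + t *\<^sub>R e" for y t
    unfolding S_def by (subst (1 2) B) (simp add: sum.insert_remove)
  have "integral\<^sup>L lborel f = integral\<^sup>L (\<Pi>\<^sub>M b\<in>Basis. lborel) (\<lambda>y. f (S y))"
    by (subst lb, subst integral_distr) auto
  also have "\<dots> = integral\<^sup>L (Pi\<^sub>M (insert e (Basis - {e})) (\<lambda>_. lborel)) (\<lambda>y. f (S y))"
    using B by simp
  also have "\<dots> = (\<integral>y. (\<integral>t. f (S (y(e := t))) \<partial>lborel) \<partial>Pi\<^sub>M (Basis - {e}) (\<lambda>_. lborel))"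
    by (rule product_integral_insert) (use int in auto)
  also have "\<dots> = 0"
    by (subst line) (simp add: lines)
  finally show ?thesis .
qed

lemma integrable_lborel_box_if_continuous:
  fixes g :: "real ^ 'd::finite \<Rightarrow> real"
  assumes g: "continuous_on (cbox a b) g"
  shows "integrable lborel (\<lambda>x. indicator (box a b) x *\<^sub>R g x)"
proof -
  have "set_integrable lborel (cbox a b) g"
    unfolding set_integrable_def by (rule borel_integrable_compact) (use g in auto)
  then show ?thesis
    unfolding set_integrable_def[symmetric]
    by (rule set_integrable_subset) (auto intro: box_subset_cbox[THEN subsetD])
qed

text \<open>
  A line parallel to the \<open>j\<close>-th axis either misses the open box or meets it in an open segment
  whose end points lie on opposite faces. On the segment the fundamental theorem of calculus gives the
  difference of two values of \<open>h\<close> that agree by assumption. The function \<open>g\<close> is the derivative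
  continued to the closed box; this makes it bounded, hence integrable.
\<close>

lemma integral_box_pd_eq_0:
  fixes h g :: "real ^ 'd::finite \<Rightarrow> real"
  assumes h: "continuous_on (cbox a b) h" "\<And>x. x \<in> box a b \<Longrightarrow> h differentiable (at x)"
    and g: "continuous_on (cbox a b) g" "\<And>x. x \<in> box a b \<Longrightarrow> g x = pd j h x"
    and faces: "\<And>x. x \<in> cbox a b \<Longrightarrow> x $ j = a $ j \<Longrightarrow> h (x + axis j (b $ j - a $ j)) = h x"
  shows "integral\<^sup>L (lebesgue_on (box a b)) g = 0"
proof -
  let ?\<phi> = "\<lambda>x. indicator (box a b) x *\<^sub>R g x"
  have \<phi>: "integrable lborel ?\<phi>"
    using integrable_lborel_box_if_continuous[OF g(1)] .
  have line: "(LBINT t. ?\<phi> (y + t *\<^sub>R axis j 1)) = 0" for y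
  proof -
    define l where "l = (\<lambda>t. y + t *\<^sub>R axis j 1)"
    \<comment> \<open>The line \<open>l\<close> crosses the two faces orthogonal to the \<open>j\<close>-th axis at the times \<open>c\<close> and \<open>d\<close>.\<close>
    define c d where "c = a $ j - y $ j" and "d = b $ j - y $ j"
    have l_nth: "l t $ i = (if i = j then y $ j + t else y $ i)" for t i
      by (simp add: l_def axis_def)
    have mem_l: "l t \<in> box a b \<longleftrightarrow>
        (\<forall>i. i \<noteq> j \<longrightarrow> a $ i < y $ i \<and> y $ i < b $ i) \<and> c < t \<and> t < d" for t
      unfolding mem_box_cart l_nth c_def d_def
      by (smt (verit, ccfv_threshold))
    have mem_l_j: "l t \<in> box a b \<Longrightarrow> c < d" for t
      using mem_l[of t] by simp
    show ?thesis
    proof (cases "(\<forall>i. i \<noteq> j \<longrightarrow> a $ i < y $ i \<and> y $ i < b $ i) \<and> c < d")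
      case False
      then have "l t \<notin> box a b" for t
        using mem_l[of t] mem_l_j[of t] by blast
      then show ?thesis by (simp add: l_def)
    next
      case True
      have box: "l t \<in> box a b \<longleftrightarrow> t \<in> {c<..<d}" for t
        using True mem_l by simp
      have cbox: "l t \<in> cbox a b" if "t \<in> {c..d}" for t
        using True that unfolding mem_box_cart l_nth by (simp add: c_def d_def less_imp_le)
      have cl: "continuous_on A l" for A
        unfolding l_def by (intro continuous_intros)
      have "((\<lambda>t. g (l t)) has_integral (h (l d) - h (l c))) {c..d}"
      proof (rule fundamental_theorem_of_calculus_interior)
        show "continuous_on {c..d} (\<lambda>t. h (l t))"
          by (rule continuous_on_compose2[OF h(1) cl]) (use cbox in auto)
        fix t assume "t \<in> {c<..<d}"
        then have t: "l t \<in> box a b" using box by simp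
        have "(l has_derivative (\<lambda>s. s *\<^sub>R axis j 1)) (at t)"
          unfolding l_def by (auto intro!: derivative_eq_intros)
        from has_derivative_compose[OF this frechet_derivative_works[THEN iffD1, OF h(2)[OF t]]]
        have "((\<lambda>t. h (l t)) has_derivative
            (\<lambda>s. frechet_derivative h (at (l t)) (s *\<^sub>R axis j 1))) (at t)" .
        moreover have "frechet_derivative h (at (l t)) (s *\<^sub>R axis j 1) = s *\<^sub>R g (l t)" for s
          using g(2)[OF t] linear_frechet_derivative[OF h(2)[OF t]]
          by (simp add: pd_def linear_cmul)
        ultimately show "((\<lambda>t. h (l t)) has_vector_derivative g (l t)) (at t)"
          by (simp add: has_vector_derivative_def)
      qed (use True in auto)
      moreover have "h (l d) = h (l c)"
      proof -
        have "l d = l c + axis j (b $ j - a $ j)"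
          by (simp add: vec_eq_iff l_nth axis_def c_def d_def)
        moreover have "l c $ j = a $ j" by (simp add: l_nth c_def)
        moreover have "l c \<in> cbox a b" using cbox True by simp
        ultimately show ?thesis using faces by simp
      qed
      ultimately have HK: "((\<lambda>t. g (l t)) has_integral 0) {c<..<d}"
        by (simp add: has_integral_Icc_iff_Ioo)
      have "set_integrable lborel {c..d} (\<lambda>t. g (l t))"
        by (rule borel_integrable_atLeastAtMost')
          (rule continuous_on_compose2[OF g(1) cl], use cbox in auto)
      then have "set_integrable lborel {c<..<d} (\<lambda>t. g (l t))"
        by (rule set_integrable_subset) auto
      from set_borel_integral_eq_integral(2)[OF this] integral_unique[OF HK]
      have "(LBINT t:{c<..<d}. g (l t)) = 0" by simp
      then show ?thesis
        unfolding set_lebesgue_integral_def indicator_def box[symmetric] by (simp add: l_def)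
    qed
  qed
  have "integral\<^sup>L (lebesgue_on (box a b)) g = integral\<^sup>L lebesgue ?\<phi>"
    by (rule integral_restrict_space) simp
  also have "\<dots> = integral\<^sup>L lborel ?\<phi>"
    by (rule integral_completion) (use \<phi> in simp)
  also have "\<dots> = 0"
    by (rule integral_lborel_eq_0_if_lines[OF _ \<phi> line]) (simp add: axis_in_Basis_iff)
  finally show ?thesis .
qed

text \<open>
  Equality at translated points of opposite faces of the closed box is the common consequence of
  periodicity and of vanishing on the boundary under which boundary terms cancel.
\<close>

definition opposite_faces_agree ::
    "real ^ 'd::finite \<Rightarrow> real ^ 'd \<Rightarrow> (real ^ 'd \<Rightarrow> 'b) \<Rightarrow> bool" where
  "opposite_faces_agree a b h \<longleftrightarrow>
     (\<forall>j. \<forall>x. x \<in> cbox a b \<longrightarrow> x $ j = a $ j \<longrightarrow> h (x + axis j (b $ j - a $ j)) = h x)"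

lemma integrable_on_box_if_continuous_extension:
  fixes f g :: "real ^ 'd::finite \<Rightarrow> real"
  assumes g: "continuous_on (cbox a b) g" and eq: "\<And>x. x \<in> box a b \<Longrightarrow> f x = g x"
  shows "integrable (lebesgue_on (box a b)) f"
proof -
  have "integrable lebesgue (\<lambda>x. indicator (box a b) x *\<^sub>R g x)"
    using integrable_lborel_box_if_continuous[OF g]
    by (subst integrable_completion) (simp, assumption)
  then have "integrable (lebesgue_on (box a b)) g"
    by (subst integrable_restrict_space) auto
  then show ?thesis
    by (rule Bochner_Integration.integrable_cong[THEN iffD1, rotated -1]) (use eq in auto)
qed

lemma C1_pd_continuous_extension:
  assumes "box a b \<noteq> {}" "Ck_closure 1 (box a b) f"
  obtains g where "continuous_on (cbox a b) g" "\<And>x. x \<in> box a b \<Longrightarrow> g x = pd j f x"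
  using assms(2) by (simp add: closure_box[OF assms(1)]) meson

text \<open>
  Apply \<open>integral_box_pd_eq_0\<close> to the product \<open>q r\<close>, whose derivative is the sum of the two integrands.
\<close>

lemma integral_by_parts_box:
  fixes q r :: "real ^ 'd::finite \<Rightarrow> real"
  assumes ne: "box a b \<noteq> {}"
    and q: "Ck_closure 1 (box a b) q" and r: "Ck_closure 1 (box a b) r"
    and faces: "opposite_faces_agree a b (\<lambda>x. q x * r x)"
  shows "integrable (lebesgue_on (box a b)) (\<lambda>x. pd j q x * r x)"
    and "integrable (lebesgue_on (box a b)) (\<lambda>x. q x * pd j r x)"
    and "integral\<^sup>L (lebesgue_on (box a b)) (\<lambda>x. pd j q x * r x) =
      - integral\<^sup>L (lebesgue_on (box a b)) (\<lambda>x. q x * pd j r x)"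
proof -
  let ?M = "lebesgue_on (box a b)"
  obtain q' where q': "continuous_on (cbox a b) q'" "\<And>x. x \<in> box a b \<Longrightarrow> q' x = pd j q x"
    using C1_pd_continuous_extension[OF ne q, where j = j] by blast
  obtain r' where r': "continuous_on (cbox a b) r'" "\<And>x. x \<in> box a b \<Longrightarrow> r' x = pd j r x"
    using C1_pd_continuous_extension[OF ne r, where j = j] by blast
  have c: "continuous_on (cbox a b) q" "continuous_on (cbox a b) r"
    and d: "\<And>x. x \<in> box a b \<Longrightarrow> q differentiable (at x)"
      "\<And>x. x \<in> box a b \<Longrightarrow> r differentiable (at x)"
    using q r by (auto simp: closure_box[OF ne])
  show 1: "integrable ?M (\<lambda>x. pd j q x * r x)"
    by (rule integrable_on_box_if_continuous_extension[OF continuous_on_mult[OF q'(1) c(2)]])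
      (simp add: q'(2))
  show 2: "integrable ?M (\<lambda>x. q x * pd j r x)"
    by (rule integrable_on_box_if_continuous_extension[OF continuous_on_mult[OF c(1) r'(1)]])
      (simp add: r'(2))
  have "integral\<^sup>L ?M (\<lambda>x. q x * pd j r x) + integral\<^sup>L ?M (\<lambda>x. pd j q x * r x) =
      integral\<^sup>L ?M (\<lambda>x. q x * pd j r x + pd j q x * r x)"
    using 1 2 by simp
  also have "\<dots> = integral\<^sup>L ?M (\<lambda>x. q x * r' x + q' x * r x)"
    by (rule Bochner_Integration.integral_cong) (auto simp: q' r')
  also have "\<dots> = 0"
  proof (rule integral_box_pd_eq_0)
    show "continuous_on (cbox a b) (\<lambda>x. q x * r x)"
      "continuous_on (cbox a b) (\<lambda>x. q x * r' x + q' x * r x)"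
      using c q' r' by (auto intro!: continuous_on_add continuous_on_mult)
    show "(\<lambda>x. q x * r x) differentiable (at x)" if "x \<in> box a b" for x
      using d that by (intro differentiable_mult) auto
    show "q x * r' x + q' x * r x = pd j (\<lambda>x. q x * r x) x" if "x \<in> box a b" for x
      using that by (simp add: pd_mult d q' r')
  qed (use faces in \<open>simp add: opposite_faces_agree_def\<close>)
  finally show "integral\<^sup>L ?M (\<lambda>x. pd j q x * r x) = - integral\<^sup>L ?M (\<lambda>x. q x * pd j r x)"
    by simp
qed

section \<open>Boundary conditions\<close>

lemma opposite_faces_agree_if_zero_on_frontier:
  assumes "\<And>i. a $ i < b $ i" "\<And>x. x \<in> frontier (box a b) \<Longrightarrow> h x = 0"
  shows "opposite_faces_agree a b h"
  unfolding opposite_faces_agree_def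
proof (intro allI impI)
  fix j x assume x: "x \<in> cbox a b" "x $ j = a $ j"
  let ?y = "x + axis j (b $ j - a $ j)"
  have "box a b \<noteq> {}"
    using assms(1) by (simp add: interval_ne_empty_cart)
  then have fr: "frontier (box a b) = cbox a b - box a b"
    by (simp add: frontier_box)
  have "x \<notin> box a b"
    using x(2) unfolding mem_box_cart by (auto intro!: exI[of _ j])
  then have "x \<in> frontier (box a b)"
    using x(1) fr by simp
  moreover have y: "?y $ i = (if i = j then b $ j else x $ i)" for i
    using x by (simp add: axis_def)
  have "?y \<in> cbox a b"
    using x assms(1) unfolding mem_box_cart y by (auto simp: less_imp_le)
  moreover have "?y \<notin> box a b"
    unfolding mem_box_cart y by (auto intro!: exI[of _ j])
  ultimately show "h ?y = h x"
    using assms(2) fr by auto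
qed

lemma opposite_faces_agree_if_periodic: "box_periodic a b h \<Longrightarrow> opposite_faces_agree a b h"
  by (simp add: box_periodic_def opposite_faces_agree_def)

lemma opposite_faces_agree_pressure_velocity:
  assumes "\<And>i. a $ i < b $ i" "pressure_field bc a b q" "velocity_field k bc a b v"
  shows "opposite_faces_agree a b (\<lambda>x. q x * v x $ i)"
proof (cases bc)
  case Dirichlet
  then show ?thesis
    using assms by (intro opposite_faces_agree_if_zero_on_frontier) auto
next
  case Periodic
  then show ?thesis
    using assms by (intro opposite_faces_agree_if_periodic) (simp add: box_periodic_def)
qed

text \<open>
  Green's formula needs the continuation \<open>g\<close> of \<open>\<partial>\<^sub>j v\<^sub>i\<close> to the closed box, since the values of
  \<open>\<partial>\<^sub>j v\<^sub>i\<close> on the boundary carry no information in the Dirichlet case. There \<open>g v\<^sub>i\<close> vanishes on the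
  boundary because \<open>v\<close> does; in the periodic case \<open>g\<close> is \<open>\<partial>\<^sub>j v\<^sub>i\<close> itself and inherits the periodicity of \<open>v\<close>.
\<close>

lemma velocity_field_pd_extension:
  assumes ab: "\<And>i. a $ i < b $ i" and v: "velocity_field k bc a b v" and k: "2 \<le> k"
  obtains g where "Ck_closure 1 (box a b) g" "\<And>x. x \<in> box a b \<Longrightarrow> g x = pd j (\<lambda>y. v y $ i) x"
    "opposite_faces_agree a b (\<lambda>x. g x * v x $ i)"
proof (cases bc)
  case Dirichlet
  have "Ck_closure (Suc 1) (box a b) (\<lambda>y. v y $ i)"
    using Ck_closure_antimono[OF Ck_closure_component[OF velocity_field_Ck_closure[OF v]], of "Suc 1"] k
    by (simp del: Ck_closure.simps)
  then obtain g where g: "Ck_closure 1 (box a b) g" "\<And>x. x \<in> box a b \<Longrightarrow> g x = pd j (\<lambda>y. v y $ i) x"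
    unfolding Ck_closure.simps(2)[of 1] by blast
  have "opposite_faces_agree a b (\<lambda>x. g x * v x $ i)"
    using ab v Dirichlet by (intro opposite_faces_agree_if_zero_on_frontier) auto
  with g show ?thesis by (rule that)
next
  case Periodic
  have "Ck_closure k UNIV v" and per: "box_periodic a b v"
    using v Periodic by auto
  then have "Ck_closure (Suc 1) UNIV (\<lambda>y. v y $ i)"
    using Ck_closure_antimono[OF Ck_closure_component, of k UNIV v "Suc 1"] k
    by (simp del: Ck_closure.simps)
  then obtain g where g: "Ck_closure 1 UNIV g" "\<And>x. g x = pd j (\<lambda>y. v y $ i) x"
    and d: "\<And>x. (\<lambda>y. v y $ i) differentiable (at x)"
    unfolding Ck_closure.simps(2)[of 1] by blast
  have "g = pd j (\<lambda>y. v y $ i)" using g(2) by auto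
  then have "box_periodic a b g"
    using pd_box_periodic[of a b "\<lambda>y. v y $ i" j] d per by (simp add: box_periodic_def)
  then have "opposite_faces_agree a b (\<lambda>x. g x * v x $ i)"
    using per by (intro opposite_faces_agree_if_periodic) (simp add: box_periodic_def)
  with g show ?thesis
    using that Ck_closure_subset[OF g(1), of "box a b"] by blast
qed

section \<open>The energy balance of one step\<close>

lemma L2_norm_squared: "(L2_norm \<Omega> f)\<^sup>2 = L2_inner \<Omega> f f"
  by (simp add: L2_norm_def L2_inner_def)

lemma velocity_field_component_C1:
  assumes "velocity_field k bc a b v" "1 \<le> k"
  shows "Ck_closure 1 (box a b) (\<lambda>x. v x $ i)"
  using Ck_closure_antimono[OF Ck_closure_component[OF velocity_field_Ck_closure[OF assms(1)]] assms(2)] .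

lemma velocity_field_continuous:
  assumes "\<And>i. a $ i < b $ i" "velocity_field k bc a b v"
  shows "continuous_on (cbox a b) v"
proof -
  have "box a b \<noteq> {}" using assms(1) by (simp add: interval_ne_empty_cart)
  then show ?thesis
    using Ck_closure_continuous[OF velocity_field_Ck_closure[OF assms(2)]] by (simp add: closure_box)
qed

text \<open>
  The reason why the pressure does no work on divergence-free fields: summing integration by parts over the
  coordinates moves the gradient onto the velocity as a divergence.
\<close>

lemma L2_inner_grad_velocity:
  assumes ab: "\<And>i. a $ i < b $ i" and q: "pressure_field bc a b q"
    and v: "velocity_field k bc a b v" and k: "1 \<le> k"
  shows "integrable (lebesgue_on (box a b)) (\<lambda>x. grad q x \<bullet> v x)"
    and "L2_inner (box a b) (grad q) v = - L2_inner (box a b) q (divergence v)"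
proof -
  let ?M = "lebesgue_on (box a b)"
  have ne: "box a b \<noteq> {}" using ab by (simp add: interval_ne_empty_cart)
  note parts = integral_by_parts_box[OF ne pressure_field_Ck_closure[OF q]
      velocity_field_component_C1[OF v k] opposite_faces_agree_pressure_velocity[OF ab q v]]
  have eq: "grad q x \<bullet> v x = (\<Sum>j\<in>UNIV. pd j q x * v x $ j)" for x
    by (simp add: grad_def inner_vec_def)
  show "integrable ?M (\<lambda>x. grad q x \<bullet> v x)"
    unfolding eq using parts(1) by simp
  have "L2_inner (box a b) (grad q) v = (\<Sum>j\<in>UNIV. integral\<^sup>L ?M (\<lambda>x. pd j q x * v x $ j))"
    unfolding L2_inner_def eq using parts(1) by simp
  also have "\<dots> = - (\<Sum>j\<in>UNIV. integral\<^sup>L ?M (\<lambda>x. q x * pd j (\<lambda>y. v y $ j) x))"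
    by (simp add: parts(3) sum_negf)
  also have "(\<Sum>j\<in>UNIV. integral\<^sup>L ?M (\<lambda>x. q x * pd j (\<lambda>y. v y $ j) x)) = L2_inner (box a b) q (divergence v)"
    unfolding L2_inner_def divergence_def using parts(2) by (simp add: sum_distrib_left)
  finally show "L2_inner (box a b) (grad q) v = - L2_inner (box a b) q (divergence v)" .
qed

text \<open>
  Green's first identity: each \<open>\<partial>\<^sub>j \<partial>\<^sub>j v\<^sub>i\<close> is integrated by parts against \<open>v\<^sub>i\<close>.
\<close>

lemma L2_inner_laplacian_velocity:
  assumes ab: "\<And>i. a $ i < b $ i" and v: "velocity_field k bc a b v" and k: "2 \<le> k"
  shows "integrable (lebesgue_on (box a b)) (\<lambda>x. laplacian v x \<bullet> v x)"
    and "L2_inner (box a b) (laplacian v) v = - (L2_norm (box a b) (Grad v))\<^sup>2"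
proof -
  let ?M = "lebesgue_on (box a b)"
  let ?d = "\<lambda>i j. pd j (\<lambda>y. v y $ i)"
  have ne: "box a b \<noteq> {}" using ab by (simp add: interval_ne_empty_cart)
  have parts: "integrable ?M (\<lambda>x. pd j (?d i j) x * v x $ i)"
      "integrable ?M (\<lambda>x. ?d i j x * ?d i j x)"
      "integral\<^sup>L ?M (\<lambda>x. pd j (?d i j) x * v x $ i) = - integral\<^sup>L ?M (\<lambda>x. ?d i j x * ?d i j x)"
    for i j
  proof -
    obtain g where g: "Ck_closure 1 (box a b) g" "\<And>x. x \<in> box a b \<Longrightarrow> g x = ?d i j x"
      "opposite_faces_agree a b (\<lambda>x. g x * v x $ i)"
      using velocity_field_pd_extension[OF ab v k] by blast
    \<comment> \<open>On the open box \<open>g\<close> is \<open>\<partial>\<^sub>j v\<^sub>i\<close>, so the second derivatives of \<open>v\<close> are derivatives of \<open>g\<close>.\<close>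
    have pdg: "pd j g x = pd j (?d i j) x" if "x \<in> box a b" for x
      using g that by (intro pd_cong_open[of "box a b"]) auto
    note p = integral_by_parts_box[OF ne g(1) velocity_field_component_C1[OF v] g(3), of j]
    show "integrable ?M (\<lambda>x. pd j (?d i j) x * v x $ i)"
      using p(1) k by (subst Bochner_Integration.integrable_cong[where g = "\<lambda>x. pd j g x * v x $ i"]) (auto simp: pdg)
    show "integrable ?M (\<lambda>x. ?d i j x * ?d i j x)"
      using p(2) k by (subst Bochner_Integration.integrable_cong[where g = "\<lambda>x. g x * ?d i j x"]) (auto simp: g)
    have "integral\<^sup>L ?M (\<lambda>x. pd j (?d i j) x * v x $ i) = integral\<^sup>L ?M (\<lambda>x. pd j g x * v x $ i)"
      by (rule Bochner_Integration.integral_cong) (auto simp: pdg)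
    also have "\<dots> = - integral\<^sup>L ?M (\<lambda>x. g x * ?d i j x)"
      using p(3) k by simp
    also have "integral\<^sup>L ?M (\<lambda>x. g x * ?d i j x) = integral\<^sup>L ?M (\<lambda>x. ?d i j x * ?d i j x)"
      by (rule Bochner_Integration.integral_cong) (auto simp: g)
    finally show "integral\<^sup>L ?M (\<lambda>x. pd j (?d i j) x * v x $ i) = - integral\<^sup>L ?M (\<lambda>x. ?d i j x * ?d i j x)" .
  qed
  have eq: "laplacian v x \<bullet> v x = (\<Sum>i\<in>UNIV. \<Sum>j\<in>UNIV. pd j (?d i j) x * v x $ i)" for x
    by (simp add: laplacian_def inner_vec_def sum_distrib_right)
  show "integrable ?M (\<lambda>x. laplacian v x \<bullet> v x)"
    unfolding eq using parts(1) by simp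
  have "L2_inner (box a b) (laplacian v) v =
      (\<Sum>i\<in>UNIV. \<Sum>j\<in>UNIV. integral\<^sup>L ?M (\<lambda>x. pd j (?d i j) x * v x $ i))"
    unfolding L2_inner_def eq using parts(1) by simp
  also have "\<dots> = - (\<Sum>i\<in>UNIV. \<Sum>j\<in>UNIV. integral\<^sup>L ?M (\<lambda>x. ?d i j x * ?d i j x))"
    by (simp add: parts(3) sum_negf)
  also have "(\<Sum>i\<in>UNIV. \<Sum>j\<in>UNIV. integral\<^sup>L ?M (\<lambda>x. ?d i j x * ?d i j x)) = L2_inner (box a b) (Grad v) (Grad v)"
    unfolding L2_inner_def Grad_def inner_vec_def using parts(2) by simp
  finally show "L2_inner (box a b) (laplacian v) v = - (L2_norm (box a b) (Grad v))\<^sup>2"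
    by (simp add: L2_norm_squared)
qed

lemma integrable_inner_in_L2:
  assumes "in_L2 \<Omega> f" "in_L2 \<Omega> g"
  shows "integrable (lebesgue_on \<Omega>) (\<lambda>x. f x \<bullet> g x)"
proof (rule Bochner_Integration.integrable_bound)
  show "integrable (lebesgue_on \<Omega>) (\<lambda>x. (norm (f x))\<^sup>2 + (norm (g x))\<^sup>2)"
    using assms by (simp add: in_L2_def)
  show "(\<lambda>x. f x \<bullet> g x) \<in> borel_measurable (lebesgue_on \<Omega>)"
    using assms by (auto simp: in_L2_def intro!: borel_measurable_inner)
  have "\<bar>f x \<bullet> g x\<bar> \<le> (norm (f x))\<^sup>2 + (norm (g x))\<^sup>2" for x
  proof -
    have "\<bar>f x \<bullet> g x\<bar> \<le> norm (f x) * norm (g x)" by (rule Cauchy_Schwarz_ineq2)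
    also have "\<dots> \<le> 2 * norm (f x) * norm (g x)" by simp
    also have "\<dots> \<le> (norm (f x))\<^sup>2 + (norm (g x))\<^sup>2" by (rule sum_squares_bound)
    finally show ?thesis .
  qed
  then show "AE x in lebesgue_on \<Omega>. norm (f x \<bullet> g x) \<le> norm ((norm (f x))\<^sup>2 + (norm (g x))\<^sup>2)"
    by simp
qed

lemma integrable_inner_if_continuous:
  fixes f g :: "real ^ 'd::finite \<Rightarrow> 'b::euclidean_space"
  assumes "continuous_on (cbox a b) f" "continuous_on (cbox a b) g"
  shows "integrable (lebesgue_on (box a b)) (\<lambda>x. f x \<bullet> g x)"
  by (rule integrable_on_box_if_continuous_extension[OF continuous_on_inner[OF assms]]) simp

lemma in_L2_if_continuous:
  fixes f :: "real ^ 'd::finite \<Rightarrow> 'b::euclidean_space"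
  assumes "continuous_on (cbox a b) f"
  shows "in_L2 (box a b) f"
  unfolding in_L2_def
proof
  show "f \<in> borel_measurable (lebesgue_on (box a b))"
    by (rule continuous_imp_measurable_on_sets_lebesgue[OF continuous_on_subset[OF assms box_subset_cbox]])
      simp
  show "integrable (lebesgue_on (box a b)) (\<lambda>x. (norm (f x))\<^sup>2)"
    using integrable_inner_if_continuous[OF assms assms] by (simp add: power2_norm_eq_inner)
qed

lemma integrable_convection_inner:
  assumes ab: "\<And>i. a $ i < b $ i" and w: "velocity_field k bc a b w" and k: "1 \<le> k"
    and v: "continuous_on (cbox a b) v"
  shows "integrable (lebesgue_on (box a b)) (\<lambda>x. convection w x \<bullet> v x)"
proof -
  have ne: "box a b \<noteq> {}" using ab by (simp add: interval_ne_empty_cart)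
  have summand: "integrable (lebesgue_on (box a b)) (\<lambda>x. w x $ j * pd j (\<lambda>y. w y $ i) x * v x $ i)" for i j
  proof -
    obtain g where g: "continuous_on (cbox a b) g" "\<And>x. x \<in> box a b \<Longrightarrow> g x = pd j (\<lambda>y. w y $ i) x"
      using C1_pd_continuous_extension[OF ne velocity_field_component_C1[OF w k, of i], where j = j] by blast
    have "continuous_on (cbox a b) (\<lambda>x. w x $ j * g x * v x $ i)"
      using velocity_field_continuous[OF ab w] v g(1)
      by (intro continuous_on_mult continuous_on_component) auto
    then show ?thesis
      by (rule integrable_on_box_if_continuous_extension) (simp add: g(2))
  qed
  have "convection w x \<bullet> v x = (\<Sum>i\<in>UNIV. \<Sum>j\<in>UNIV. w x $ j * pd j (\<lambda>y. w y $ i) x * v x $ i)" for x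
    by (simp add: convection_def inner_vec_def sum_distrib_right)
  then show ?thesis
    using summand by simp
qed

text \<open>
  The energy neutrality of \<open>B\<close> is antisymmetry, \<open>(F,v) (G,v) - (G,v) (F,v) = 0\<close>. Integrability of both
  parts allows the integral to be split.
\<close>

lemma L2_inner_B_map_eq_0:
  assumes Fv: "integrable (lebesgue_on \<Omega>) (\<lambda>x. F w x \<bullet> v x)"
    and Gv: "integrable (lebesgue_on \<Omega>) (\<lambda>x. G_map \<Omega> F w x \<bullet> v x)"
  shows "integrable (lebesgue_on \<Omega>) (\<lambda>x. B_map \<Omega> F w v x \<bullet> v x)"
    and "L2_inner \<Omega> (B_map \<Omega> F w v) v = 0"
  using assms
  by (simp_all add: B_map_def inner_diff_left L2_inner_def[of \<Omega> "B_map \<Omega> F w v"])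
    (simp add: L2_inner_def)

text \<open>
  One step tested with its own midpoint. The field \<open>w\<close> stays arbitrary, so that the lemma applies to
  \<open>w = u\<^sup>n\<close> and to the extrapolation from two earlier iterates.
\<close>

lemma energy_law_if_CN_step:
  fixes F :: "(real ^ 'd::finite \<Rightarrow> real ^ 'd) \<Rightarrow> real ^ 'd \<Rightarrow> real ^ 'd"
  assumes ab: "\<And>i. a $ i < b $ i" and k: "2 \<le> k"
    and w: "velocity_field k bc a b w" and Fw: "in_L2 (box a b) (F w)"
    and un: "velocity_field k bc a b (u n)" and un1: "velocity_field k bc a b (u (Suc n))"
    and p: "pressure_field bc a b (p n)"
    and f: "\<And>x. x \<in> box a b \<Longrightarrow> f (real n * \<tau> + \<tau> / 2) x = 0"
    and step: "CN_step (box a b) \<nu> \<tau> F f w u p n"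
  shows "energy_law (box a b) \<nu> \<tau> u n"
proof -
  let ?\<Omega> = "box a b"
  let ?M = "lebesgue_on ?\<Omega>"
  define v where "v = midpoint_field u n"
  have v_eq: "v x = (1/2) *\<^sub>R u n x + (1/2) *\<^sub>R u (Suc n) x" for x
    by (simp add: v_def midpoint_field_def scaleR_add_right)
  have v: "velocity_field k bc a b v"
    using velocity_field_lincomb[OF un un1, of "1/2" "1/2"] v_eq by presburger
  note cont = velocity_field_continuous[OF ab]
  have k1: "1 \<le> k" using k by simp
  have Gv: "integrable ?M (\<lambda>x. G_map ?\<Omega> F w x \<bullet> v x)"
    using integrable_convection_inner[OF ab w k1 cont[OF v]]
    by (cases "L2_norm ?\<Omega> w = 0") (simp_all add: G_map_def)
  note B = L2_inner_B_map_eq_0[where F = F, OF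
      integrable_inner_in_L2[OF Fw in_L2_if_continuous[OF cont[OF v]]] Gv]
  note L = L2_inner_laplacian_velocity[OF ab v k]
  note P = L2_inner_grad_velocity[OF ab p v k1]
  have eqn: "(u (Suc n) x - u n x) /\<^sub>R \<tau> - \<nu> *\<^sub>R laplacian v x + B_map ?\<Omega> F w v x + grad (p n) x = 0"
    and div: "divergence v x = 0" if "x \<in> ?\<Omega>" for x
    using step that f by (auto simp: CN_step_def v_def)
  have "L2_inner ?\<Omega> (p n) (divergence v) = integral\<^sup>L ?M (\<lambda>x. 0)"
    unfolding L2_inner_def by (rule Bochner_Integration.integral_cong) (auto simp: div)
  with P(2) have P0: "L2_inner ?\<Omega> (grad (p n)) v = 0" by simp
  have tested: "(u (Suc n) x \<bullet> u (Suc n) x - u n x \<bullet> u n x) / (2 * \<tau>) =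
      \<nu> * (laplacian v x \<bullet> v x) - B_map ?\<Omega> F w v x \<bullet> v x - grad (p n) x \<bullet> v x" if "x \<in> ?\<Omega>" for x
  proof -
    have test: "(u (Suc n) x - u n x) \<bullet> v x = (u (Suc n) x \<bullet> u (Suc n) x - u n x \<bullet> u n x) / 2"
      unfolding v_eq
      by (simp add: inner_diff_left inner_add_right inner_commute[of "u (Suc n) x" "u n x"] diff_divide_distrib)
    have "s / (2 * \<tau>) = inverse \<tau> * (s / 2)" for s
      by (simp add: field_simps)
    then have "(u (Suc n) x \<bullet> u (Suc n) x - u n x \<bullet> u n x) / (2 * \<tau>) = ((u (Suc n) x - u n x) /\<^sub>R \<tau>) \<bullet> v x"
      by (simp only: inner_scaleR_left test)
    also have "(u (Suc n) x - u n x) /\<^sub>R \<tau> = \<nu> *\<^sub>R laplacian v x - B_map ?\<Omega> F w v x - grad (p n) x"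
      using eqn[OF that] by (simp add: algebra_simps eq_neg_iff_add_eq_0)
    finally show ?thesis by (simp add: inner_diff_left)
  qed
  have "(energy ?\<Omega> (u (Suc n)) - energy ?\<Omega> (u n)) / \<tau> =
      integral\<^sup>L ?M (\<lambda>x. (u (Suc n) x \<bullet> u (Suc n) x - u n x \<bullet> u n x) / (2 * \<tau>))"
    using integrable_inner_if_continuous[OF cont[OF un] cont[OF un]]
      integrable_inner_if_continuous[OF cont[OF un1] cont[OF un1]]
    by (simp add: energy_def L2_norm_squared L2_inner_def diff_divide_distrib)
  also have "\<dots> = integral\<^sup>L ?M (\<lambda>x. \<nu> * (laplacian v x \<bullet> v x) - B_map ?\<Omega> F w v x \<bullet> v x - grad (p n) x \<bullet> v x)"
    by (rule Bochner_Integration.integral_cong) (auto simp: tested)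
  also have "\<dots> = \<nu> * L2_inner ?\<Omega> (laplacian v) v - L2_inner ?\<Omega> (B_map ?\<Omega> F w v) v
      - L2_inner ?\<Omega> (grad (p n)) v"
    unfolding L2_inner_def[of _ "laplacian v"] L2_inner_def[of _ "B_map ?\<Omega> F w v"]
      L2_inner_def[of _ "grad (p n)"]
    using L(1) B(1) P(1) by simp
  also have "\<dots> = - \<nu> * (L2_norm ?\<Omega> (Grad v))\<^sup>2"
    by (simp add: L(2) B(2) P0)
  finally show ?thesis
    by (simp add: energy_law_def v_def)
qed

theorem theorem3p1:
  fixes a b :: "real ^ 'd::finite"
    and \<Omega> :: "(real ^ 'd) set"
    and \<nu> T \<tau> :: real and N k :: nat
    and bc :: boundary_condition
    and F :: "(real ^ 'd \<Rightarrow> real ^ 'd) \<Rightarrow> (real ^ 'd \<Rightarrow> real ^ 'd)"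
    and f :: "real \<Rightarrow> real ^ 'd \<Rightarrow> real ^ 'd"
    and u :: "nat \<Rightarrow> real ^ 'd \<Rightarrow> real ^ 'd"
    and p :: "nat \<Rightarrow> real ^ 'd \<Rightarrow> real"
  assumes dim: "CARD('d) = 2 \<or> CARD('d) = 3"
    and rectangle: "\<And>i. a $ i < b $ i" "\<Omega> = box a b"
    and "\<nu> > 0" "T > 0" "N > 0"
    and regularity: "k \<ge> 2"
    and step_size: "\<tau> = T / real N"
    and F_L2: "\<And>v. velocity_field k bc a b v \<Longrightarrow> in_L2 \<Omega> (F v)"
    and F_nondegenerate:
      "\<And>v. velocity_field k bc a b v \<Longrightarrow> L2_norm \<Omega> v \<noteq> 0 \<Longrightarrow> L2_inner \<Omega> (F v) v \<noteq> 0"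
    and no_force: "\<And>t x. t \<in> {0..T} \<Longrightarrow> x \<in> \<Omega> \<Longrightarrow> f t x = 0"
    and velocities: "\<And>n. n \<le> N \<Longrightarrow> velocity_field k bc a b (u n)"
    and pressures: "\<And>n. n < N \<Longrightarrow> pressure_field bc a b (p n)"
  shows "(CN1_scheme \<Omega> \<nu> \<tau> F f N u p \<longrightarrow> (\<forall>n<N. energy_law \<Omega> \<nu> \<tau> u n)) \<and>
         (CN2_scheme \<Omega> \<nu> \<tau> F f N u p \<longrightarrow> (\<forall>n. 1 \<le> n \<and> n < N \<longrightarrow> energy_law \<Omega> \<nu> \<tau> u n))"
proof -
  have ab: "\<And>i. a $ i < b $ i" and \<Omega>: "\<Omega> = box a b"
    using rectangle by auto
  \<comment> \<open>The force is sampled at \<open>(n + 1/2) \<tau>\<close>, which lies in \<open>[0, T]\<close> for \<open>n < N\<close>.\<close>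
  have law: "energy_law \<Omega> \<nu> \<tau> u n"
    if n: "n < N" and w: "velocity_field k bc a b w" and step: "CN_step \<Omega> \<nu> \<tau> F f w u p n" for n w
  proof -
    have \<tau>: "\<tau> > 0" and T: "\<tau> * real N = T"
      using \<open>T > 0\<close> \<open>N > 0\<close> step_size by simp_all
    have "\<tau> * (real n + 1 / 2) \<le> \<tau> * real N"
      using n \<tau> by (intro mult_left_mono) auto
    then have "real n * \<tau> + \<tau> / 2 \<le> T"
      unfolding T by (simp add: algebra_simps)
    moreover have "0 \<le> real n * \<tau> + \<tau> / 2"
      using \<tau> by simp
    ultimately have "f (real n * \<tau> + \<tau> / 2) x = 0" if "x \<in> \<Omega>" for x
      using no_force that by simp
    then show ?thesis
      using energy_law_if_CN_step[OF ab regularity w, of F u n p f \<tau> \<nu>]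
        F_L2[OF w] velocities[of n] velocities[of "Suc n"] pressures[OF n] n step
      by (simp add: \<Omega>)
  qed
  have extrapolated: "velocity_field k bc a b (extrapolated_field u n)" if "1 \<le> n" "n < N" for n
  proof -
    have extrapolated_eq: "extrapolated_field u n = (\<lambda>x. (3/2) *\<^sub>R u n x + (-1/2) *\<^sub>R u (n - 1) x)"
      by (auto simp: extrapolated_field_def scaleR_diff_right)
    then show ?thesis
      unfolding extrapolated_eq
      by (intro velocity_field_lincomb velocities) (use that in auto)
  qed
  show ?thesis
    unfolding CN1_scheme_def CN2_scheme_def CN1_step_def CN2_step_def
    using law[OF _ velocities] law[OF _ extrapolated] by (meson less_imp_le)
qed

end
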